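(* Let $\gamma<0$ and assume that [Noise], [Factors], [Portfolio], [Growth] and [Minorization] (as described in the context) hold. Then, for sufficiently small weights $\beta>0$, the operator $T_\gamma$ is a local contraction under $\|\cdot\|_{\beta,\omega\text{-span}}$, in the following sense: there exist functions $\beta\colon\mathbb{R}_+\to(0,1)$ and $L\colon\mathbb{R}_+\to(0,1)$ such that, for every $M\in\mathbb{R}_+$, $$\|T_\gamma f_1-T_\gamma f_2\|_{\beta(M),\omega\text{-span}}\le L(M)\,\|f_1-f_2\|_{\beta(M),\omega\text{-span}}$$ for all $f_1,f_2\in\mathcal{C}_\omega(\mathbb{R}^k)$ with $\|f_1\|_{\omega\text{-span}}\le M$ and $\|f_2\|_{\omega\text{-span}}\le M$.
   Context: Time set $\mathbb{T}=\mathbb{N}=\{0,1,2,\dots\}$; $(\Omega,\mathcal{F},\{\mathcal{F}_t\}_{t\in\mathbb{T}},\mathbb{P})$ is a filtered probability space with $\mathcal{F}_0$ trivial and $\mathcal{F}=\bigcup_t\mathcal{F}_t$; $\mathbb{E}$ is expectation under $\mathbb{P}$. $k,m$ are positive integers, $U\subset\mathbb{R}^m$ is a nonempty compact set, and $\mathcal{A}$ is the set of all $U$-valued adapted processes $H=(H_t)_{t\in\mathbb{T}}$ (portfolio strategies). $\mathcal{B}(\mathbb{R}^k)$ is the Borel $\sigma$-algebra. [Noise] The filtration is generated by a sequence $W=(W_t)_{t\in\mathbb{T}}$ of i.i.d. $\mathbb{R}^{k+m}$-valued random vectors, with $W_t$ independent of $\mathcal{F}_t$ for each $t$. [Factors]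 The factor process satisfies $X_0\in\mathbb{R}^k$ and $X_{t+1}=G(X_t,W_t)$, where $G\colon\mathbb{R}^k\times\mathbb{R}^{k+m}\to\mathbb{R}^k$ is Borel measurable and continuous in the first variable. [Portfolio] For each $H\in\mathcal{A}$ the portfolio value process satisfies $V_0^H=V_0>0$ and $\ln(V_{t+1}^H/V_t^H)=F(X_t,H_t,W_t)$, where $F\colon\mathbb{R}^k\times U\times\mathbb{R}^{k+m}\to\mathbb{R}$ is Borel measurable and continuous with respect to the first two variables. [Growth] There are Borel functions $a_1,a_2\colon\mathbb{R}^{k+m}\to\mathbb{R}_+$, constants $b_1\in(0,1)$, $b_2>0$ and a continuous function $\omega\colon\mathbb{R}^k\to[0,\infty)$ (the weight function) such that $\omega(G(x,w))\le a_1(w)+b_1\omega(x)$ and $|F(x,h,w)|\le a_2(w)+b_2\omega(x)$ for all $x\in\mathbb{R}^k$, $h\in U$, $w\in\mathbb{R}^{k+m}$; moreover $\mu^{\gamma}(a_1(W_0))$ and $\mu^{\gamma}(a_2(W_0))$ are finite for every $\gamma\in\mathbb{R}$, where $\mu^\gamma(Z)=\frac1\gamma\ln\mathbb{E}[e^{\gamma Z}]$ for $\gamma\ne0$ and $\mu^0(Z)=\mathbb{E}[Z]$. [Minorization] For every $R>0$ there exist a constant $c>0$ and a probability measure $\nu$ on $\mathbb{R}^k$ such that $\inf_{x:\,\omega(x)\le R}\mathbb{P}[G(x,W_0)\in A]\ge c\,\nu(A)$ for all $A\in\mathcal{B}(\mathbb{R}^k)$. $\mathcal{C}_\omega(\mathbb{R}^k)$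 is the set of continuous $f\colon\mathbb{R}^k\to\mathbb{R}$ with $\|f\|_\omega:=\sup_x\frac{|f(x)|}{1+\omega(x)}<\infty$. Seminorms: $\|f\|_{\omega\text{-span}}:=\sup_{x,y}\frac{f(x)-f(y)}{2+\omega(x)+\omega(y)}$ and, for $\beta>0$, $\|f\|_{\beta,\omega\text{-span}}:=\sup_{x,y}\frac{f(x)-f(y)}{2+\beta\omega(x)+\beta\omega(y)}$. For $f\in\mathcal{C}_\omega(\mathbb{R}^k)$: $T_\gamma f(x):=\inf_{h\in U}\ln\mathbb{E}\big[e^{\gamma F(x,h,W_0)+f(G(x,W_0))}\big]$. *)

theory Defs
  imports "HOL-Probability.Probability"
begin

section \<open>Filtered probability space and noise\<close>

text \<open>The total \<open>\<sigma>\<close>-algebra is the one generated by the union of the \<open>\<sigma>\<close>-algebras of the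
  filtration (the union itself is in general only an algebra). Time is \<^typ>\<open>nat\<close>.\<close>

definition filtered_prob_space :: "'a measure \<Rightarrow> (nat \<Rightarrow> 'a measure) \<Rightarrow> bool" where
  "filtered_prob_space P Fil \<longleftrightarrow>
     prob_space P \<and> filtration (space P) Fil \<and> (\<forall>t. subalgebra P (Fil t)) \<and>
     sets (Fil 0) = {{}, space P} \<and>
     sets P = sigma_sets (space P) (\<Union>t. sets (Fil t))"

text \<open>Since \<open>W t\<close> is independent of \<open>Fil t\<close>, the \<open>\<sigma>\<close>-algebra \<open>Fil t\<close> is generated by the
  noise strictly before time \<open>t\<close>; in particular \<open>Fil 0\<close> is trivial.\<close>

definition noise ::
  "'a measure \<Rightarrow> (nat \<Rightarrow> 'a measure) \<Rightarrow> (nat \<Rightarrow> 'a \<Rightarrow> 'w::topological_space) \<Rightarrow> bool" where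
  "noise P Fil W \<longleftrightarrow>
     prob_space.indep_vars P (\<lambda>_. borel) W UNIV \<and>
     (\<forall>t. distr P borel (W t) = distr P borel (W 0)) \<and>
     (\<forall>t. sets (Fil t) =
        sigma_sets (space P) {W s -` A \<inter> space P | s A. s < t \<and> A \<in> sets borel}) \<and>
     (\<forall>t. prob_space.indep_set P (sets (Fil t)) {W t -` A \<inter> space P | A. A \<in> sets borel})"

definition strategies ::
  "'a measure \<Rightarrow> (nat \<Rightarrow> 'a measure) \<Rightarrow> 'u::topological_space set \<Rightarrow> (nat \<Rightarrow> 'a \<Rightarrow> 'u) set" where
  "strategies P Fil U =
     {H. \<forall>t. H t \<in> Fil t \<rightarrow>\<^sub>M borel \<and> (\<forall>s\<in>space P. H t s \<in> U)}"


section \<open>Factors and portfolio\<close>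

definition factors ::
  "'a measure \<Rightarrow> (nat \<Rightarrow> 'a \<Rightarrow> 'w::topological_space) \<Rightarrow> ('x::topological_space \<Rightarrow> 'w \<Rightarrow> 'x)
     \<Rightarrow> 'x \<Rightarrow> (nat \<Rightarrow> 'a \<Rightarrow> 'x) \<Rightarrow> bool" where
  "factors P W G x0 X \<longleftrightarrow>
     (\<lambda>(x, w). G x w) \<in> borel \<Otimes>\<^sub>M borel \<rightarrow>\<^sub>M borel \<and>
     (\<forall>w. continuous_on UNIV (\<lambda>x. G x w)) \<and>
     (\<forall>s\<in>space P. X 0 s = x0 \<and> (\<forall>t. X (Suc t) s = G (X t s) (W t s)))"

text \<open>\<open>V H t\<close> is the portfolio value at time \<open>t\<close> under the strategy \<open>H\<close>. The values of
  \<open>F x h w\<close> for \<open>h\<close> outside \<open>U\<close> are irrelevant throughout.\<close>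

definition portfolio ::
  "'a measure \<Rightarrow> (nat \<Rightarrow> 'a measure) \<Rightarrow> (nat \<Rightarrow> 'a \<Rightarrow> 'w::topological_space) \<Rightarrow>
   'u::topological_space set \<Rightarrow> (nat \<Rightarrow> 'a \<Rightarrow> 'x::topological_space) \<Rightarrow>
   ('x \<Rightarrow> 'u \<Rightarrow> 'w \<Rightarrow> real) \<Rightarrow> real \<Rightarrow> ((nat \<Rightarrow> 'a \<Rightarrow> 'u) \<Rightarrow> nat \<Rightarrow> 'a \<Rightarrow> real) \<Rightarrow> bool" where
  "portfolio P Fil W U X F V0 V \<longleftrightarrow>
     (\<lambda>(x, h, w). F x h w) \<in> borel_measurable (borel \<Otimes>\<^sub>M restrict_space borel U \<Otimes>\<^sub>M borel) \<and>
     (\<forall>w. continuous_on (UNIV \<times> U) (\<lambda>(x, h). F x h w)) \<and>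
     0 < V0 \<and>
     (\<forall>H\<in>strategies P Fil U. \<forall>s\<in>space P.
        V H 0 s = V0 \<and>
        (\<forall>t. 0 < V H t s \<and> ln (V H (Suc t) s / V H t s) = F (X t s) (H t s) (W t s)))"


section \<open>Growth and minorization\<close>

definition ext_ln :: "ennreal \<Rightarrow> ereal" where
  "ext_ln x = (if x = 0 then - \<infinity> else if x = \<infinity> then \<infinity> else ereal (ln (enn2real x)))"

text \<open>The entropic utility \<open>\<mu>\<^sup>\<gamma>(Z)\<close>, with values in the extended reals so that its finiteness
  is a genuine condition.\<close>

definition entropic_utility :: "'a measure \<Rightarrow> real \<Rightarrow> ('a \<Rightarrow> real) \<Rightarrow> ereal" where
  "entropic_utility P \<gamma> Z =
     (if \<gamma> = 0
      then enn2ereal (\<integral>\<^sup>+ s. ennreal (Z s) \<partial>P) - enn2ereal (\<integral>\<^sup>+ s. ennreal (- Z s) \<partial>P)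
      else ereal (1 / \<gamma>) * ext_ln (\<integral>\<^sup>+ s. ennreal (exp (\<gamma> * Z s)) \<partial>P))"

definition growth ::
  "'a measure \<Rightarrow> (nat \<Rightarrow> 'a \<Rightarrow> 'w::topological_space) \<Rightarrow> 'u set \<Rightarrow>
   ('x::topological_space \<Rightarrow> 'w \<Rightarrow> 'x) \<Rightarrow> ('x \<Rightarrow> 'u \<Rightarrow> 'w \<Rightarrow> real) \<Rightarrow> ('x \<Rightarrow> real) \<Rightarrow> bool" where
  "growth P W U G F \<omega> \<longleftrightarrow>
     continuous_on UNIV \<omega> \<and> (\<forall>x. 0 \<le> \<omega> x) \<and>
     (\<exists>a1 a2 b1 b2.
        a1 \<in> borel_measurable borel \<and> a2 \<in> borel_measurable borel \<and>
        (\<forall>w. 0 \<le> a1 w) \<and> (\<forall>w. 0 \<le> a2 w) \<and>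
        0 < b1 \<and> b1 < 1 \<and> 0 < b2 \<and>
        (\<forall>x w. \<omega> (G x w) \<le> a1 w + b1 * \<omega> x) \<and>
        (\<forall>x. \<forall>h\<in>U. \<forall>w. \<bar>F x h w\<bar> \<le> a2 w + b2 * \<omega> x) \<and>
        (\<forall>\<gamma>. \<bar>entropic_utility P \<gamma> (\<lambda>s. a1 (W 0 s))\<bar> \<noteq> \<infinity> \<and>
             \<bar>entropic_utility P \<gamma> (\<lambda>s. a2 (W 0 s))\<bar> \<noteq> \<infinity>))"

text \<open>The infimum is taken in \<^typ>\<open>ennreal\<close>, hence is \<open>\<infinity>\<close> if no \<open>x\<close> satisfies \<open>\<omega> x \<le> R\<close>.\<close>

definition minorization ::
  "'a measure \<Rightarrow> (nat \<Rightarrow> 'a \<Rightarrow> 'w) \<Rightarrow> ('x::topological_space \<Rightarrow> 'w \<Rightarrow> 'x) \<Rightarrow> ('x \<Rightarrow> real) \<Rightarrow> bool"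
  where
  "minorization P W G \<omega> \<longleftrightarrow>
     (\<forall>R>0. \<exists>c>0. \<exists>\<nu>. prob_space \<nu> \<and> sets \<nu> = sets borel \<and>
        (\<forall>A\<in>sets borel.
           ennreal c * emeasure \<nu> A
             \<le> (INF x\<in>{x. \<omega> x \<le> R}. emeasure P {s \<in> space P. G x (W 0 s) \<in> A})))"


section \<open>Weighted spaces, span seminorms and the operator\<close>

definition weighted_norm :: "('x \<Rightarrow> real) \<Rightarrow> ('x \<Rightarrow> real) \<Rightarrow> ereal" where
  "weighted_norm \<omega> f = (SUP x. ereal (\<bar>f x\<bar> / (1 + \<omega> x)))"

definition weighted_space :: "('x::topological_space \<Rightarrow> real) \<Rightarrow> ('x \<Rightarrow> real) set" where
  "weighted_space \<omega> = {f. continuous_on UNIV f \<and> weighted_norm \<omega> f < \<infinity>}"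

definition span_seminorm :: "('x \<Rightarrow> real) \<Rightarrow> ('x \<Rightarrow> real) \<Rightarrow> ereal" where
  "span_seminorm \<omega> f = (SUP (x, y). ereal ((f x - f y) / (2 + \<omega> x + \<omega> y)))"

definition span_seminorm_scaled :: "real \<Rightarrow> ('x \<Rightarrow> real) \<Rightarrow> ('x \<Rightarrow> real) \<Rightarrow> ereal" where
  "span_seminorm_scaled \<beta> \<omega> f = (SUP (x, y). ereal ((f x - f y) / (2 + \<beta> * \<omega> x + \<beta> * \<omega> y)))"

text \<open>Under the growth condition, for \<open>f\<close> in the weighted space and nonempty \<open>U\<close>, the integrand
  is integrable with positive integral and the infimum is over a set bounded below, so the
  real-valued integral, logarithm and infimum agree with the extended ones.\<close>

definition risk_operator ::
  "'a measure \<Rightarrow> (nat \<Rightarrow> 'a \<Rightarrow> 'w) \<Rightarrow> 'u set \<Rightarrow> ('x \<Rightarrow> 'w \<Rightarrow> 'x) \<Rightarrow> ('x \<Rightarrow> 'u \<Rightarrow> 'w \<Rightarrow> real) \<Rightarrow>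
   real \<Rightarrow> ('x \<Rightarrow> real) \<Rightarrow> 'x \<Rightarrow> real" where
  "risk_operator P W U G F \<gamma> f x =
     (INF h\<in>U. ln (\<integral>s. exp (\<gamma> * F x h (W 0 s) + f (G x (W 0 s))) \<partial>P))"

end

theory Submission
  imports Defs
begin

text \<open>
  Write \<open>Q_f(x, h)\<close> for the law of \<open>G x W\<close> under the measure with density proportional to
  \<open>exp (\<gamma> F x h W + f (G x W))\<close>. By Jensen's inequality the difference of
  \<open>T f1 - T f2\<close> between \<open>x\<close> and \<open>y\<close> is at most the integral of \<open>f1 - f2\<close> against
  \<open>Q_f1(x, h) - Q_f2(y, h')\<close> for near-optimal \<open>h\<close> and \<open>h'\<close>, so the argument of Hairer and
  Mattingly applies once the tilted kernels satisfy a drift and a Dobrushin condition that are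
  uniform over \<open>f\<close> with bounded span.

  Drift: by Jensen's inequality for \<open>exp (p a1)\<close>, the tilted mean of \<open>a1\<close> is at most \<open>1/p\<close> times a
  quantity affine in \<open>\<omega> x\<close> whose slope does not depend on \<open>p\<close>; a large \<open>p\<close> makes the drift contract.
  Dobrushin condition: the tilting density is not bounded below, because \<open>a1\<close> and \<open>a2\<close> are not
  bounded, but the Cauchy-Schwarz inequality still yields \<open>Q(A) \<ge> \<eta> \<nu>(A)^2\<close> on sublevel sets of
  \<open>\<omega>\<close>. As \<open>\<nu>(A)^2 + \<nu>(-A)^2 \<ge> 1/2\<close>, this keeps any two such kernels at total variation distance
  less than 1.
\<close>

section \<open>Exponential tilting\<close>

text \<open>The normaliser is a Bochner integral: if \<open>exp Z\<close> is not integrable it is 0,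
  and division by 0 makes the tilt the zero measure. The facts below therefore assume
  integrability.\<close>

definition tilt :: "'a measure \<Rightarrow> ('a \<Rightarrow> real) \<Rightarrow> 'a measure" where
  "tilt M Z = density M (\<lambda>s. ennreal (exp (Z s) / (\<integral>t. exp (Z t) \<partial>M)))"

lemma space_tilt [simp]: "space (tilt M Z) = space M"
  and sets_tilt [measurable_cong, simp]: "sets (tilt M Z) = sets M"
  by (simp_all add: tilt_def)

context prob_space
begin

lemma integral_exp_pos:
  fixes Z :: "'a \<Rightarrow> real"
  assumes "integrable M (\<lambda>s. exp (Z s))"
  shows "0 < (\<integral>s. exp (Z s) \<partial>M)"
  using expectation_greater[OF assms, of 0] by simp

lemma integrable_tilt_iff:
  fixes Z u :: "'a \<Rightarrow> real"
  assumes "integrable M (\<lambda>s. exp (Z s))" "Z \<in> borel_measurable M" "u \<in> borel_measurable M"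
  shows "integrable (tilt M Z) u \<longleftrightarrow> integrable M (\<lambda>s. exp (Z s) * u s)"
proof -
  have pos: "0 < (\<integral>s. exp (Z s) \<partial>M)" by (rule integral_exp_pos[OF assms(1)])
  have "integrable (tilt M Z) u \<longleftrightarrow>
      integrable M (\<lambda>s. (exp (Z s) / (\<integral>t. exp (Z t) \<partial>M)) * u s)"
    unfolding tilt_def using assms pos by (subst integrable_density) auto
  also have "(\<lambda>s. (exp (Z s) / (\<integral>t. exp (Z t) \<partial>M)) * u s) =
      (\<lambda>s. inverse (\<integral>t. exp (Z t) \<partial>M) * (exp (Z s) * u s))"
    by (auto simp: field_simps)
  also have "integrable M \<dots> \<longleftrightarrow> integrable M (\<lambda>s. exp (Z s) * u s)"
    using pos by (subst integrable_mult_left_iff) simp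
  finally show ?thesis .
qed

lemma integral_tilt:
  fixes Z u :: "'a \<Rightarrow> real"
  assumes "integrable M (\<lambda>s. exp (Z s))" "Z \<in> borel_measurable M" "u \<in> borel_measurable M"
  shows "(\<integral>s. u s \<partial>tilt M Z) = (\<integral>s. exp (Z s) * u s \<partial>M) / (\<integral>s. exp (Z s) \<partial>M)"
proof -
  have pos: "0 < (\<integral>s. exp (Z s) \<partial>M)" by (rule integral_exp_pos[OF assms(1)])
  have "(\<integral>s. u s \<partial>tilt M Z) = (\<integral>s. (exp (Z s) / (\<integral>t. exp (Z t) \<partial>M)) * u s \<partial>M)"
    unfolding tilt_def using assms pos by (subst integral_density) auto
  also have "\<dots> = (\<integral>s. (exp (Z s) * u s) / (\<integral>t. exp (Z t) \<partial>M) \<partial>M)"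
    by (intro Bochner_Integration.integral_cong) auto
  finally show ?thesis by simp
qed

lemma prob_space_tilt:
  fixes Z :: "'a \<Rightarrow> real"
  assumes "integrable M (\<lambda>s. exp (Z s))" "Z \<in> borel_measurable M"
  shows "prob_space (tilt M Z)"
proof
  have pos: "0 < (\<integral>s. exp (Z s) \<partial>M)" by (rule integral_exp_pos[OF assms(1)])
  have "emeasure (tilt M Z) (space (tilt M Z)) =
      (\<integral>\<^sup>+s. ennreal (exp (Z s) / (\<integral>t. exp (Z t) \<partial>M)) \<partial>M)"
    unfolding tilt_def using assms by (subst emeasure_density) (auto intro!: nn_integral_cong)
  also have "\<dots> = ennreal (\<integral>s. exp (Z s) / (\<integral>t. exp (Z t) \<partial>M) \<partial>M)"
    using assms pos by (intro nn_integral_eq_integral) auto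
  also have "\<dots> = 1" using pos by simp
  finally show "emeasure (tilt M Z) (space (tilt M Z)) = 1" .
qed

text \<open>Jensen's inequality, obtained by integrating the tangent line of \<open>exp\<close> at
  the mean \<open>m\<close>.\<close>

lemma integral_le_ln_integral_exp:
  fixes u :: "'a \<Rightarrow> real"
  assumes "integrable M u" "integrable M (\<lambda>s. exp (u s))"
  shows "(\<integral>s. u s \<partial>M) \<le> ln (\<integral>s. exp (u s) \<partial>M)"
proof -
  define m where "m = (\<integral>s. u s \<partial>M)"
  have "exp m = (\<integral>s. exp m * (1 + (u s - m)) \<partial>M)"
    using assms(1) by (simp add: m_def prob_space)
  also have "\<dots> \<le> (\<integral>s. exp (u s) \<partial>M)"
  proof (rule integral_mono)
    fix s
    have "exp m * (1 + (u s - m)) \<le> exp m * exp (u s - m)"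
      by (intro mult_left_mono exp_ge_add_one_self) auto
    then show "exp m * (1 + (u s - m)) \<le> exp (u s)" by (simp add: exp_diff)
  qed (use assms in auto)
  finally show ?thesis
    using integral_exp_pos[OF assms(2)] by (simp add: m_def ln_ge_iff)
qed

text \<open>The quotient of the normalisers is the mean of \<open>exp (Z2 - Z1)\<close> under the
  tilt by \<open>Z1\<close>. Jensen's inequality bounds its logarithm from below by the tilted mean
  of \<open>Z2 - Z1\<close>.\<close>

lemma ln_integral_exp_diff_le:
  fixes Z1 Z2 :: "'a \<Rightarrow> real"
  assumes "integrable M (\<lambda>s. exp (Z1 s))" "integrable M (\<lambda>s. exp (Z2 s))"
    and [measurable]: "Z1 \<in> borel_measurable M" "Z2 \<in> borel_measurable M"
    and "integrable (tilt M Z1) (\<lambda>s. Z1 s - Z2 s)"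
  shows "ln (\<integral>s. exp (Z1 s) \<partial>M) - ln (\<integral>s. exp (Z2 s) \<partial>M) \<le> (\<integral>s. Z1 s - Z2 s \<partial>tilt M Z1)"
proof -
  interpret Q: prob_space "tilt M Z1" using assms by (intro prob_space_tilt) auto
  have eq: "exp (Z1 s) * exp (Z2 s - Z1 s) = exp (Z2 s)" for s
    by (simp add: exp_diff)
  have int: "integrable (tilt M Z1) (\<lambda>s. Z2 s - Z1 s)"
    using Bochner_Integration.integrable_minus[OF assms(5)] by simp
  have "(\<integral>s. Z2 s - Z1 s \<partial>tilt M Z1) \<le> ln (\<integral>s. exp (Z2 s - Z1 s) \<partial>tilt M Z1)"
    using assms int by (intro Q.integral_le_ln_integral_exp) (auto simp: integrable_tilt_iff eq)
  also have "\<dots> = ln ((\<integral>s. exp (Z2 s) \<partial>M) / (\<integral>s. exp (Z1 s) \<partial>M))"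
    using assms by (subst integral_tilt) (auto simp: eq)
  also have "\<dots> = ln (\<integral>s. exp (Z2 s) \<partial>M) - ln (\<integral>s. exp (Z1 s) \<partial>M)"
    using integral_exp_pos[OF assms(1)] integral_exp_pos[OF assms(2)] by (simp add: ln_div)
  finally have "(\<integral>s. Z2 s - Z1 s \<partial>tilt M Z1) \<le> \<dots>" .
  moreover have "(\<integral>s. Z2 s - Z1 s \<partial>tilt M Z1) = - (\<integral>s. Z1 s - Z2 s \<partial>tilt M Z1)"
    by (subst Bochner_Integration.integral_minus[symmetric]) simp
  ultimately show ?thesis by linarith
qed

section \<open>Exponents at a controlled distance from a constant\<close>

lemma integrable_exp_le:
  fixes Y Z :: "'a \<Rightarrow> real"
  assumes "integrable M (\<lambda>s. exp (Y s))" "Z \<in> borel_measurable M" "\<And>s. Z s \<le> Y s + c"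
  shows "integrable M (\<lambda>s. exp (Z s))"
proof (rule Bochner_Integration.integrable_bound)
  show "integrable M (\<lambda>s. exp c * exp (Y s))" using assms(1) by simp
  show "AE s in M. norm (exp (Z s)) \<le> norm (exp c * exp (Y s))"
    using assms(3) by (auto simp: exp_add[symmetric] add.commute)
qed (use assms in auto)

lemma integral_exp_le:
  fixes Y Z :: "'a \<Rightarrow> real"
  assumes "integrable M (\<lambda>s. exp (Y s))" "Z \<in> borel_measurable M" "\<And>s. Z s \<le> Y s + c"
  shows "(\<integral>s. exp (Z s) \<partial>M) \<le> exp c * (\<integral>s. exp (Y s) \<partial>M)"
proof -
  have "(\<integral>s. exp (Z s) \<partial>M) \<le> (\<integral>s. exp c * exp (Y s) \<partial>M)"
    using assms integrable_exp_le[OF assms]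
    by (intro integral_mono integrable_mult_right) (auto simp: exp_add[symmetric] add.commute)
  then show ?thesis by simp
qed

text \<open>Tilting ignores additive constants, so the centre \<open>k\<close> cancels in tilted
  quantities. \<open>Y\<close> is a random error, \<open>t\<close> a deterministic one; in the
  application these are \<open>f x\<close>, \<open>noise_bound K\<close> and an affine function of
  \<open>\<omega> x\<close>.\<close>

context
  fixes Z Y :: "'a \<Rightarrow> real" and k t :: real
  assumes Z [measurable]: "Z \<in> borel_measurable M"
    and Y [measurable]: "Y \<in> borel_measurable M"
    and Y_nonneg: "\<And>s. 0 \<le> Y s"
    and exp_Y: "integrable M (\<lambda>s. exp (Y s))"
    and Z_bound: "\<And>s. \<bar>Z s - k\<bar> \<le> Y s + t"
begin

lemma integrable_exp_bounded: "integrable M (\<lambda>s. exp (Z s))"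
  by (rule integrable_exp_le[OF exp_Y, of _ "k + t"])
     (auto, use Z_bound in \<open>smt (verit)\<close>)

lemma ln_integral_exp_bounded:
  "k - t + ln (\<integral>s. exp (- Y s) \<partial>M) \<le> ln (\<integral>s. exp (Z s) \<partial>M)"
proof -
  have i: "integrable M (\<lambda>s. exp (- Y s))"
    by (rule integrable_exp_le[OF exp_Y, of _ 0]) (use Y_nonneg in auto)
  have "(\<integral>s. exp (- Y s) \<partial>M) \<le> exp (t - k) * (\<integral>s. exp (Z s) \<partial>M)"
    by (rule integral_exp_le[OF integrable_exp_bounded])
       (auto, use Z_bound in \<open>smt (verit)\<close>)
  then have "ln (\<integral>s. exp (- Y s) \<partial>M) \<le> ln (exp (t - k) * (\<integral>s. exp (Z s) \<partial>M))"
    using integral_exp_pos[OF i] integral_exp_pos[OF integrable_exp_bounded] by (subst ln_le_cancel_iff) auto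
  also have "\<dots> = t - k + ln (\<integral>s. exp (Z s) \<partial>M)"
    using integral_exp_pos[OF integrable_exp_bounded] by (subst ln_mult) auto
  finally show ?thesis by simp
qed

text \<open>Jensen's inequality under the tilt is applied to \<open>p * a\<close>. The numerator and
  the denominator of the resulting quotient contribute one \<open>t\<close> each;
  \<open>2 * t\<close> carries no factor \<open>p\<close>, so dividing by a large \<open>p\<close>
  makes its share small.\<close>

lemma tilt_moment_bound:
  fixes a :: "'a \<Rightarrow> real"
  assumes a [measurable]: "a \<in> borel_measurable M" and a_nonneg: "\<And>s. 0 \<le> a s"
    and p: "0 < p" and i: "integrable M (\<lambda>s. exp (p * a s + Y s))"
  shows "integrable (tilt M Z) a"
    and "(\<integral>s. a s \<partial>tilt M Z) \<le>
      (ln (\<integral>s. exp (p * a s + Y s) \<partial>M) - ln (\<integral>s. exp (- Y s) \<partial>M) + 2 * t) / p"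
proof -
  note iZ = integrable_exp_bounded
  interpret Q: prob_space "tilt M Z" by (rule prob_space_tilt[OF iZ Z])
  have le: "p * a s + Z s \<le> (p * a s + Y s) + (k + t)" for s
    using Z_bound[of s] by linarith
  have ipa: "integrable M (\<lambda>s. exp (p * a s + Z s))"
    by (rule integrable_exp_le[OF i _ le]) simp
  have iq: "integrable (tilt M Z) (\<lambda>s. exp (p * a s))"
    using ipa by (subst integrable_tilt_iff[OF iZ]) (auto simp: exp_add mult.commute)
  have ia: "integrable (tilt M Z) (\<lambda>s. p * a s)"
  proof (rule Bochner_Integration.integrable_bound[OF iq])
    have "p * a s \<le> exp (p * a s)" for s
      using exp_ge_add_one_self[of "p * a s"] by linarith
    then show "AE s in tilt M Z. norm (p * a s) \<le> norm (exp (p * a s))"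
      using p a_nonneg by simp
  qed simp
  then show int: "integrable (tilt M Z) a" using p by simp
  have "p * (\<integral>s. a s \<partial>tilt M Z) = (\<integral>s. p * a s \<partial>tilt M Z)" by simp
  also have "\<dots> \<le> ln (\<integral>s. exp (p * a s) \<partial>tilt M Z)"
    by (rule Q.integral_le_ln_integral_exp[OF ia iq])
  also have "(\<integral>s. exp (p * a s) \<partial>tilt M Z) =
      (\<integral>s. exp (p * a s + Z s) \<partial>M) / (\<integral>s. exp (Z s) \<partial>M)"
    by (subst integral_tilt[OF iZ]) (auto simp: exp_add mult.commute)
  also have "ln \<dots> = ln (\<integral>s. exp (p * a s + Z s) \<partial>M) - ln (\<integral>s. exp (Z s) \<partial>M)"
    using integral_exp_pos[OF ipa] integral_exp_pos[OF iZ] by (simp add: ln_div)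
  also have "ln (\<integral>s. exp (p * a s + Z s) \<partial>M) \<le>
      ln (exp (k + t) * (\<integral>s. exp (p * a s + Y s) \<partial>M))"
    using integral_exp_le[OF i _ le] integral_exp_pos[OF i] integral_exp_pos[OF ipa]
    by (subst ln_le_cancel_iff) auto
  also have "\<dots> = k + t + ln (\<integral>s. exp (p * a s + Y s) \<partial>M)"
    using integral_exp_pos[OF i] by (subst ln_mult) auto
  finally have "p * (\<integral>s. a s \<partial>tilt M Z) \<le>
      ln (\<integral>s. exp (p * a s + Y s) \<partial>M) - ln (\<integral>s. exp (- Y s) \<partial>M) + 2 * t"
    using ln_integral_exp_bounded by linarith
  then show "(\<integral>s. a s \<partial>tilt M Z) \<le>
      (ln (\<integral>s. exp (p * a s + Y s) \<partial>M) - ln (\<integral>s. exp (- Y s) \<partial>M) + 2 * t) / p"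
    using p by (simp add: field_simps)
qed

text \<open>By Cauchy-Schwarz the squared mass of \<open>A\<close> is at most the integral of
  \<open>exp (Z - k)\<close> over \<open>A\<close> times the integral of \<open>exp (k - Z)\<close>.
  The latter and the centred normaliser are both at most \<open>I\<close>, hence the square in the
  denominator.\<close>

lemma tilt_measure_ge:
  assumes A [measurable]: "A \<in> sets M" and t: "t \<le> T"
  shows "(measure M A)\<^sup>2 / ((\<integral>s. exp (Y s) \<partial>M) * exp T)\<^sup>2 \<le> measure (tilt M Z) A"
proof -
  note iZ = integrable_exp_bounded
  define I where "I = (\<integral>s. exp (Y s) \<partial>M) * exp T"
  define v where "v = (\<integral>s. exp (Z s - k) * indicator A s \<partial>M)"
  define m where "m = measure M A"
  have I: "0 < I" using integral_exp_pos[OF exp_Y] by (simp add: I_def)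
  \<comment> \<open>The sign \<open>c\<close> treats \<open>exp (Z - k)\<close> and
    \<open>exp (k - Z)\<close> at once.\<close>
  have le: "c * (Z s - k) \<le> Y s + T" if "\<bar>c\<bar> = 1" for c s
    using Z_bound[of s] that t by (auto simp: abs_if split: if_splits)
  have i: "integrable M (\<lambda>s. exp (c * (Z s - k)))" if "\<bar>c\<bar> = 1" for c
    by (rule integrable_exp_le[OF exp_Y _ le[OF that]]) simp
  have up: "(\<integral>s. exp (c * (Z s - k)) \<partial>M) \<le> I" if "\<bar>c\<bar> = 1" for c
    using integral_exp_le[OF exp_Y _ le[OF that]] by (simp add: I_def mult.commute)
  have iA: "integrable M (\<lambda>s. exp (Z s - k) * indicator A s)"
    using i[of 1] by (intro integrable_real_mult_indicator A) simp
  have v: "0 \<le> v" unfolding v_def by (intro integral_nonneg_AE) auto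
  have "m\<^sup>2 \<le> I * v"
  proof (cases "m = 0")
    case False
    then have m: "0 < m" by (simp add: m_def less_le)
    \<comment> \<open>Cauchy-Schwarz as optimized AM-GM: \<open>2 \<le> l e^r + e^(-r) / l\<close>, where \<open>r = Z - k\<close>\<close>
    define l where "l = I / m"
    have l: "0 < l" using m I by (simp add: l_def)
    have "m = (\<integral>s. indicator A s \<partial>M)" by (simp add: m_def)
    also have "\<dots> \<le> (\<integral>s. l * (exp (Z s - k) * indicator A s) / 2 + exp (- 1 * (Z s - k)) / l / 2 \<partial>M)"
    proof (rule integral_mono)
      fix s
      have "2 \<le> l * exp r + exp (- r) / l" for r :: real
      proof -
        define y where "y = l * exp r"
        have y: "0 < y" using l by (simp add: y_def)
        have "0 \<le> (y - 1)\<^sup>2" by simp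
        then have "2 \<le> y + 1 / y"
          using y by (simp add: field_simps power2_eq_square)
        also have "1 / y = exp (- r) / l"
          by (simp add: y_def exp_minus inverse_eq_divide)
        finally show ?thesis by (simp add: y_def)
      qed
      from this[of "Z s - k"] l
      show "indicat_real A s \<le> l * (exp (Z s - k) * indicator A s) / 2 + exp (- 1 * (Z s - k)) / l / 2"
        by (auto simp: indicator_def)
    qed (use iA i[of "- 1"] in
        \<open>auto simp: integrable_indicator_iff less_top[symmetric] intro!: Bochner_Integration.integrable_add\<close>)
    also have "\<dots> = l * v / 2 + (\<integral>s. exp (- 1 * (Z s - k)) \<partial>M) / l / 2"
      using iA i[of "- 1"] by (subst Bochner_Integration.integral_add) (auto simp: v_def)
    also have "\<dots> \<le> l * v / 2 + I / l / 2"
      using up[of "- 1"] l by (intro add_left_mono divide_right_mono) auto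
    \<comment> \<open>The choice of \<open>l\<close> turns the second summand into
      \<open>m / 2\<close>, which the left side \<open>m\<close> absorbs.\<close>
    also have "\<dots> = I * v / m / 2 + m / 2"
      using I by (simp add: l_def)
    finally show ?thesis using m by (simp add: field_simps power2_eq_square)
  qed (use I v in simp)
  then have "m\<^sup>2 / I\<^sup>2 \<le> v / I"
    using I by (simp add: power2_eq_square field_simps)
  also have "\<dots> \<le> v / (\<integral>s. exp (Z s - k) \<partial>M)"
    using v up[of 1] I integral_exp_pos[of "\<lambda>s. Z s - k"] i[of 1]
    by (intro divide_left_mono) auto
  also have "\<dots> = (\<integral>s. exp (Z s) * indicator A s \<partial>M) / (\<integral>s. exp (Z s) \<partial>M)"
    by (simp add: v_def exp_diff)
  also have "\<dots> = (\<integral>s. indicator A s \<partial>tilt M Z)"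
    by (subst integral_tilt[OF iZ]) auto
  also have "\<dots> = measure (tilt M Z) A" by simp
  finally show ?thesis by (simp add: I_def m_def)
qed

end

end

section \<open>Weighted Dobrushin estimate\<close>

text \<open>The squared minorant is not a measure, so it cannot be subtracted as a common component
  of \<open>q1\<close> and \<open>q2\<close>. It suffices to test the set \<open>A\<close> where
  \<open>d\<close> is nonnegative: \<open>q1(A) + q2(-A) = 2 - q1(-A) - q2(A)\<close>, and the
  subtracted masses add up to at least \<open>\<eta> / 2\<close>.\<close>

lemma weighted_dobrushin:
  fixes q1 q2 \<nu> :: "'x::topological_space measure" and d \<phi> :: "'x \<Rightarrow> real"
  assumes "prob_space q1" "prob_space q2" "prob_space \<nu>"
    and sets: "sets q1 = sets borel" "sets q2 = sets borel" "sets \<nu> = sets borel"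
    and d [measurable]: "d \<in> borel_measurable borel"
    and "integrable q1 \<phi>" "integrable q2 \<phi>"
    and d_bound: "\<And>z. \<bar>d z\<bar> \<le> s * (1 + \<phi> z)" and \<phi>: "\<And>z. 0 \<le> \<phi> z" and s: "0 \<le> s"
    and \<eta>: "0 \<le> \<eta>"
    and minor: "\<And>A. A \<in> sets borel \<Longrightarrow> \<eta> * (measure \<nu> A)\<^sup>2 \<le> measure q1 A"
      "\<And>A. A \<in> sets borel \<Longrightarrow> \<eta> * (measure \<nu> A)\<^sup>2 \<le> measure q2 A"
  shows "(\<integral>z. d z \<partial>q1) - (\<integral>z. d z \<partial>q2) \<le>
    s * (2 - \<eta> / 2 + (\<integral>z. \<phi> z \<partial>q1) + (\<integral>z. \<phi> z \<partial>q2))"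
proof -
  interpret q1: prob_space q1 by fact
  interpret q2: prob_space q2 by fact
  interpret \<nu>: prob_space \<nu> by fact
  note [measurable_cong] = sets
  have space: "space q1 = UNIV" "space q2 = UNIV" "space \<nu> = UNIV"
    using sets[THEN sets_eq_imp_space_eq] by auto
  \<comment> \<open>\<open>d\<close> is at most \<open>s \<phi>\<close> off \<open>A\<close>, and \<open>- d\<close> is at most \<open>s \<phi>\<close> on \<open>A\<close>\<close>
  define A where "A = {z. 0 \<le> d z}"
  have A [measurable]: "A \<in> sets borel" unfolding A_def by measurable
  have id: "integrable q d" if "integrable q \<phi>" "prob_space q" "sets q = sets borel" for q
  proof (rule Bochner_Integration.integrable_bound)
    interpret prob_space q by fact
    show "integrable q (\<lambda>z. s * (1 + \<phi> z))" using that(1) by simp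
    show "AE z in q. norm (d z) \<le> norm (s * (1 + \<phi> z))"
      using d_bound s \<phi> by (auto simp: order_trans[OF d_bound])
    show "d \<in> borel_measurable q" using d by (simp add: that(3) cong: measurable_cong_sets)
  qed
  have bound: "(\<integral>z. c * d z \<partial>q) \<le> s * measure q B + s * (\<integral>z. \<phi> z \<partial>q)"
    if q: "integrable q \<phi>" "prob_space q" "sets q = sets borel"
      and B: "B \<in> sets borel" and le: "\<And>z. c * d z \<le> s * indicator B z + s * \<phi> z" for q B c
  proof -
    interpret prob_space q by fact
    have iB: "integrable q (indicat_real B)" using B q(3) by (simp add: integrable_indicator_iff less_top[symmetric])
    have "(\<integral>z. c * d z \<partial>q) \<le> (\<integral>z. s * indicator B z + s * \<phi> z \<partial>q)"
      by (intro integral_mono) (use id[OF q] q(1) iB le in auto)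
    also have "\<dots> = s * measure q B + s * (\<integral>z. \<phi> z \<partial>q)"
      using iB q B by simp
    finally show ?thesis .
  qed
  have "d z \<le> s * indicator A z + s * \<phi> z" for z
    using d_bound[of z] s \<phi>[of z] by (auto simp: A_def indicator_def algebra_simps)
      (smt (verit) mult_nonneg_nonneg)
  then have 1: "(\<integral>z. 1 * d z \<partial>q1) \<le> s * measure q1 A + s * (\<integral>z. \<phi> z \<partial>q1)"
    by (intro bound) (use assms in auto)
  have "- d z \<le> s * indicator (- A) z + s * \<phi> z" for z
    using d_bound[of z] s \<phi>[of z] by (auto simp: A_def indicator_def algebra_simps)
      (smt (verit) mult_nonneg_nonneg)
  then have 2: "(\<integral>z. - 1 * d z \<partial>q2) \<le> s * measure q2 (- A) + s * (\<integral>z. \<phi> z \<partial>q2)"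
    by (intro bound) (use assms in auto)
  have c: "measure q1 (- A) = 1 - measure q1 A" "measure q2 (- A) = 1 - measure q2 A"
    "measure \<nu> (- A) = 1 - measure \<nu> A"
    using q1.prob_compl[of A] q2.prob_compl[of A] \<nu>.prob_compl[of A]
    by (auto simp: space sets Compl_eq_Diff_UNIV)
  \<comment> \<open>The sum \<open>m^2 + (1 - m)^2\<close> has its minimum 1/2 at
    \<open>m = 1 / 2\<close>.\<close>
  have "0 \<le> (1 - 2 * measure \<nu> A)\<^sup>2" by simp
  then have "1 / 2 \<le> (measure \<nu> A)\<^sup>2 + (measure \<nu> (- A))\<^sup>2"
    by (simp add: c power2_eq_square algebra_simps)
  then have "\<eta> * (1 / 2) \<le> \<eta> * ((measure \<nu> A)\<^sup>2 + (measure \<nu> (- A))\<^sup>2)"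
    using \<eta> by (intro mult_left_mono)
  also have "\<dots> \<le> measure q1 (- A) + measure q2 A"
    using minor(1)[of "- A"] minor(2)[of A] by (simp add: algebra_simps)
  finally have "measure q1 A + measure q2 (- A) \<le> 2 - \<eta> / 2" by (simp add: c)
  then have "s * (measure q1 A + measure q2 (- A)) \<le> s * (2 - \<eta> / 2)"
    using s by (intro mult_left_mono)
  with 1 2 show ?thesis by (simp add: algebra_simps)
qed

section \<open>Differences of infima and centering of functions\<close>

lemma INF_diff_diff_le:
  fixes a1 a2 c1 c2 :: "'u \<Rightarrow> real"
  assumes "U \<noteq> {}" "bdd_below (a1 ` U)" "bdd_below (a2 ` U)" "bdd_below (c1 ` U)" "bdd_below (c2 ` U)"
    and le: "\<And>h h'. h \<in> U \<Longrightarrow> h' \<in> U \<Longrightarrow> (a1 h - a2 h) + (c2 h' - c1 h') \<le> K"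
  shows "((INF h\<in>U. a1 h) - (INF h\<in>U. a2 h)) - ((INF h\<in>U. c1 h) - (INF h\<in>U. c2 h)) \<le> K"
proof (rule field_le_epsilon)
  fix e :: real assume e: "0 < e"
  \<comment> \<open>Near-minimisers are chosen for \<open>a2\<close> and \<open>c1\<close>, whose
    infima enter with a minus sign; the other two infima are bounded by the values at the same
    points.\<close>
  obtain h where h: "h \<in> U" "a2 h < (INF h\<in>U. a2 h) + e / 2"
    using cINF_less_iff[OF assms(1,3), of "(INF h\<in>U. a2 h) + e / 2"] e by auto
  obtain h' where h': "h' \<in> U" "c1 h' < (INF h\<in>U. c1 h) + e / 2"
    using cINF_less_iff[OF assms(1,4), of "(INF h\<in>U. c1 h) + e / 2"] e by auto
  have "(INF h\<in>U. a1 h) \<le> a1 h" "(INF h\<in>U. c2 h) \<le> c2 h'"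
    using h h' assms by (auto intro: cINF_lower)
  with le[OF h(1) h'(1)] h h'
  show "((INF h\<in>U. a1 h) - (INF h\<in>U. a2 h)) - ((INF h\<in>U. c1 h) - (INF h\<in>U. c2 h)) \<le> K + e"
    by linarith
qed

text \<open>By hypothesis every value of \<open>- d - s * (1 + \<phi>)\<close> lies below every
  value of \<open>s * (1 + \<phi>) - d\<close>, even at different points, so one constant separates
  the two families.\<close>

lemma span_centering:
  fixes d \<phi> :: "'x \<Rightarrow> real"
  assumes "\<And>x y. d x - d y \<le> s * (2 + \<phi> x + \<phi> y)"
  shows "\<exists>c. \<forall>z. \<bar>d z + c\<bar> \<le> s * (1 + \<phi> z)"
proof -
  define c where "c = (INF x. s * (1 + \<phi> x) - d x)"
  have *: "- (d y + s * (1 + \<phi> y)) \<le> s * (1 + \<phi> x) - d x" for x y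
    using assms[of x y] by (simp add: algebra_simps)
  then have "bdd_below (range (\<lambda>x. s * (1 + \<phi> x) - d x))"
    by (intro bdd_belowI2)
  then have "c \<le> s * (1 + \<phi> z) - d z" for z
    unfolding c_def by (intro cINF_lower) auto
  moreover have "- (d z + s * (1 + \<phi> z)) \<le> c" for z
    unfolding c_def using * by (intro cINF_greatest) auto
  ultimately show ?thesis by (intro exI[of _ c] allI) (smt (verit))
qed

section \<open>Tilted transition kernels\<close>

text \<open>The operator looks one period ahead, so \<open>W\<close> stands for the noise at time 0;
  the entropic condition appears as exponential integrability of every order.\<close>

locale growth_model = prob_space P for P :: "'a measure" +
  fixes W :: "'a \<Rightarrow> 'w::topological_space" and U :: "'u set"
    and G :: "'x::topological_space \<Rightarrow> 'w \<Rightarrow> 'x" and F :: "'x \<Rightarrow> 'u \<Rightarrow> 'w \<Rightarrow> real"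
    and \<omega> :: "'x \<Rightarrow> real" and \<gamma> :: real
    and a1 a2 :: "'w \<Rightarrow> real" and b1 b2 :: real
  assumes W [measurable]: "W \<in> P \<rightarrow>\<^sub>M borel"
    and G [measurable]: "\<And>x. G x \<in> borel \<rightarrow>\<^sub>M borel"
    and F: "\<And>x h. h \<in> U \<Longrightarrow> F x h \<in> borel_measurable borel"
    and \<omega> [measurable]: "\<omega> \<in> borel_measurable borel"
    and a [measurable]: "a1 \<in> borel_measurable borel" "a2 \<in> borel_measurable borel"
    and \<omega>_nonneg: "\<And>x. 0 \<le> \<omega> x" and a_nonneg: "\<And>w. 0 \<le> a1 w" "\<And>w. 0 \<le> a2 w"
    and b1: "0 < b1" "b1 < 1" and b2: "0 < b2"
    and \<omega>_G: "\<And>x w. \<omega> (G x w) \<le> a1 w + b1 * \<omega> x"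
    and F_bound: "\<And>x h w. h \<in> U \<Longrightarrow> \<bar>F x h w\<bar> \<le> a2 w + b2 * \<omega> x"
    and exp_moments: "\<And>p. integrable P (\<lambda>s. exp (p * a1 (W s)))"
      "\<And>p. integrable P (\<lambda>s. exp (p * a2 (W s)))"
begin

definition payoff :: "('x \<Rightarrow> real) \<Rightarrow> 'x \<Rightarrow> 'u \<Rightarrow> 'a \<Rightarrow> real" where
  "payoff f x h s = \<gamma> * F x h (W s) + f (G x (W s))"

text \<open>The random part of the distance from \<open>payoff f x h\<close> to \<open>f x\<close>:
  \<open>F\<close> contributes \<open>a2\<close>, the weight at the next state contributes
  \<open>a1\<close>.\<close>

definition noise_bound :: "real \<Rightarrow> 'a \<Rightarrow> real" where
  "noise_bound K s = \<bar>\<gamma>\<bar> * a2 (W s) + K * a1 (W s)"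

text \<open>Real inequalities replace the extended-real supremum, and measurability replaces
  continuity.\<close>

definition span_bounded :: "real \<Rightarrow> ('x \<Rightarrow> real) \<Rightarrow> bool" where
  "span_bounded K f \<longleftrightarrow>
    f \<in> borel_measurable borel \<and> (\<forall>x y. f x - f y \<le> K * (2 + \<omega> x + \<omega> y))"

definition kernel :: "('x \<Rightarrow> real) \<Rightarrow> 'x \<Rightarrow> 'u \<Rightarrow> 'x measure" where
  "kernel f x h = distr (tilt P (payoff f x h)) borel (\<lambda>s. G x (W s))"

lemma noise_bound_measurable [measurable]: "noise_bound K \<in> borel_measurable P"
  unfolding noise_bound_def[abs_def] by measurable

lemma noise_bound_nonneg: "0 \<le> K \<Longrightarrow> 0 \<le> noise_bound K s"
  by (simp add: noise_bound_def a_nonneg)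

text \<open>\<open>a1 (W s)\<close> and \<open>a2 (W s)\<close> may be dependent, so the exponential
  of their sum is not factored but dominated by exponentials of doubled order.\<close>

lemma integrable_exp_noise:
  "integrable P (\<lambda>s. exp (p * a1 (W s) + noise_bound K s))"
proof (rule Bochner_Integration.integrable_bound)
  show "integrable P (\<lambda>s. exp ((2 * (p + K)) * a1 (W s)) + exp ((2 * \<bar>\<gamma>\<bar>) * a2 (W s)))"
    by (intro Bochner_Integration.integrable_add exp_moments)
  have "exp (u + v) \<le> exp (2 * u) + exp (2 * v)" for u v :: real
  proof -
    have "exp (u + v) \<le> exp (2 * max u v)" by (auto simp: max_def)
    also have "\<dots> \<le> exp (2 * u) + exp (2 * v)" by (auto simp: max_def)
    finally show ?thesis .
  qed
  from this[of "(p + K) * a1 (W _)" "\<bar>\<gamma>\<bar> * a2 (W _)"]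
  show "AE s in P. norm (exp (p * a1 (W s) + noise_bound K s)) \<le>
      norm (exp ((2 * (p + K)) * a1 (W s)) + exp ((2 * \<bar>\<gamma>\<bar>) * a2 (W s)))"
    by (auto simp: noise_bound_def algebra_simps intro!: AE_I2 order_trans[OF _ abs_ge_self])
qed measurable

lemma integrable_exp_noise_bound: "integrable P (\<lambda>s. exp (noise_bound K s))"
  using integrable_exp_noise[of 0 K] by simp

section \<open>A single tilted kernel\<close>

context
  fixes K :: real and f :: "'x \<Rightarrow> real" and h :: 'u
  assumes K: "0 \<le> K" and f: "span_bounded K f" and h: "h \<in> U"
begin

lemma f_measurable [measurable]: "f \<in> borel_measurable borel"
  using f by (simp add: span_bounded_def)

lemma payoff_measurable [measurable]: "payoff f x h \<in> borel_measurable P"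
proof -
  note [measurable] = F[OF h]
  show ?thesis unfolding payoff_def[abs_def] by measurable
qed

text \<open>The span controls \<open>f\<close> only up to a constant, hence the centre
  \<open>f x\<close>. In the slope, \<open>F\<close> accounts for
  \<open>\<bar>\<gamma>\<bar> * b2\<close>, and the weights at \<open>x\<close> and at the next
  state for \<open>K\<close> each, with \<open>b1\<close> rounded up to 1.\<close>

lemma payoff_bound:
  "\<bar>payoff f x h s - f x\<bar> \<le> noise_bound K s + (2 * K + (\<bar>\<gamma>\<bar> * b2 + 2 * K) * \<omega> x)"
proof -
  let ?z = "G x (W s)"
  have "\<bar>f ?z - f x\<bar> \<le> K * (2 + \<omega> x + \<omega> ?z)"
    using f by (auto simp: span_bounded_def abs_le_iff) (metis add.commute add.left_commute)
  also have "\<dots> \<le> K * (2 + \<omega> x + (a1 (W s) + 1 * \<omega> x))"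
    using K b1 \<omega>_nonneg by (intro mult_left_mono add_left_mono order_trans[OF \<omega>_G] mult_right_mono) auto
  finally have 1: "\<bar>f ?z - f x\<bar> \<le> K * (2 + \<omega> x + (a1 (W s) + 1 * \<omega> x))" .
  have "\<bar>\<gamma> * F x h (W s)\<bar> \<le> \<bar>\<gamma>\<bar> * (a2 (W s) + b2 * \<omega> x)"
    unfolding abs_mult by (intro mult_left_mono F_bound h) auto
  with 1 show ?thesis by (simp add: payoff_def noise_bound_def algebra_simps)
qed

lemmas payoff_facts =
  payoff_measurable noise_bound_measurable noise_bound_nonneg[OF K] integrable_exp_noise_bound payoff_bound

lemma integrable_exp_payoff: "integrable P (\<lambda>s. exp (payoff f x h s))"
  by (rule integrable_exp_bounded[OF payoff_facts])

lemma prob_space_kernel: "prob_space (kernel f x h)"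
  unfolding kernel_def
  by (intro prob_space.prob_space_distr prob_space_tilt integrable_exp_payoff payoff_measurable) measurable

lemma sets_kernel: "sets (kernel f x h) = sets borel"
  by (simp add: kernel_def)

text \<open>\<open>\<omega>_G\<close> leaves only the tilted mean of \<open>a1\<close> to bound. The
  exponent \<open>p\<close> stays free for \<open>uniform_drift\<close>.\<close>

lemma kernel_drift:
  assumes p: "0 < p"
  shows "integrable (kernel f x h) \<omega>"
    and "(\<integral>z. \<omega> z \<partial>kernel f x h) \<le> b1 * \<omega> x +
      (ln (\<integral>s. exp (p * a1 (W s) + noise_bound K s) \<partial>P) - ln (\<integral>s. exp (- noise_bound K s) \<partial>P)
       + 2 * (2 * K + (\<bar>\<gamma>\<bar> * b2 + 2 * K) * \<omega> x)) / p"
proof -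
  let ?Q = "tilt P (payoff f x h)"
  interpret Q: prob_space ?Q by (intro prob_space_tilt integrable_exp_payoff payoff_measurable)
  have a: "(\<lambda>s. a1 (W s)) \<in> borel_measurable P" by simp
  note m = tilt_moment_bound[OF payoff_facts a a_nonneg(1) p integrable_exp_noise, of x]
  have i: "integrable ?Q (\<lambda>s. \<omega> (G x (W s)))"
  proof (rule Bochner_Integration.integrable_bound)
    show "integrable ?Q (\<lambda>s. a1 (W s) + b1 * \<omega> x)" using m(1) by simp
    show "AE s in ?Q. norm (\<omega> (G x (W s))) \<le> norm (a1 (W s) + b1 * \<omega> x)"
      using \<omega>_nonneg a_nonneg b1 \<omega>_G by (auto intro!: AE_I2 order_trans[OF _ abs_ge_self])
  qed measurable
  then show "integrable (kernel f x h) \<omega>"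
    unfolding kernel_def by (subst integrable_distr_eq) auto
  have "(\<integral>z. \<omega> z \<partial>kernel f x h) = (\<integral>s. \<omega> (G x (W s)) \<partial>?Q)"
    unfolding kernel_def by (subst integral_distr) auto
  also have "\<dots> \<le> (\<integral>s. a1 (W s) + b1 * \<omega> x \<partial>?Q)"
    using i m(1) \<omega>_G by (intro integral_mono) auto
  also have "\<dots> = b1 * \<omega> x + (\<integral>s. a1 (W s) \<partial>?Q)"
    using m(1) Q.prob_space by simp
  finally show "(\<integral>z. \<omega> z \<partial>kernel f x h) \<le> b1 * \<omega> x +
      (ln (\<integral>s. exp (p * a1 (W s) + noise_bound K s) \<partial>P) - ln (\<integral>s. exp (- noise_bound K s) \<partial>P)
       + 2 * (2 * K + (\<bar>\<gamma>\<bar> * b2 + 2 * K) * \<omega> x)) / p"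
    using m(2) by linarith
qed

lemma kernel_measure_ge:
  assumes A [measurable]: "A \<in> sets borel" and R: "\<omega> x \<le> R"
  shows "(prob {s \<in> space P. G x (W s) \<in> A})\<^sup>2 /
      ((\<integral>s. exp (noise_bound K s) \<partial>P) * exp (2 * K + (\<bar>\<gamma>\<bar> * b2 + 2 * K) * R))\<^sup>2
    \<le> measure (kernel f x h) A"
proof -
  have "2 * K + (\<bar>\<gamma>\<bar> * b2 + 2 * K) * \<omega> x \<le> 2 * K + (\<bar>\<gamma>\<bar> * b2 + 2 * K) * R"
    using R K b2 by (intro add_left_mono mult_left_mono) auto
  moreover have "{s \<in> space P. G x (W s) \<in> A} \<in> sets P" by measurable
  moreover have "measure (kernel f x h) A = measure (tilt P (payoff f x h)) {s \<in> space P. G x (W s) \<in> A}"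
    unfolding kernel_def by (subst measure_distr) (auto intro!: arg_cong2[where f = measure])
  ultimately show ?thesis
    using tilt_measure_ge[OF payoff_facts] by simp
qed

lemma ln_integral_exp_payoff_ge:
  "f x - (2 * K + (\<bar>\<gamma>\<bar> * b2 + 2 * K) * \<omega> x) + ln (\<integral>s. exp (- noise_bound K s) \<partial>P)
    \<le> ln (\<integral>s. exp (payoff f x h s) \<partial>P)"
  by (rule ln_integral_exp_bounded[OF payoff_facts])

end

text \<open>For equal \<open>x\<close> and \<open>h\<close> the terms \<open>\<gamma> * F\<close>
  cancel, and only \<open>f1 - f2\<close> at the next state remains.\<close>

lemma ln_integral_diff_le:
  assumes K: "0 \<le> K" and f: "span_bounded K f1" "span_bounded K f2" and h: "h \<in> U"
    and i: "integrable (kernel f1 x h) (\<lambda>z. f1 z - f2 z)"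
  shows "ln (\<integral>s. exp (payoff f1 x h s) \<partial>P) - ln (\<integral>s. exp (payoff f2 x h s) \<partial>P)
    \<le> (\<integral>z. f1 z - f2 z \<partial>kernel f1 x h)"
proof -
  note [measurable] = payoff_measurable[OF K f(1) h] payoff_measurable[OF K f(2) h]
    f_measurable[OF K f(1) h] f_measurable[OF K f(2) h]
  have eq: "payoff f1 x h s - payoff f2 x h s = f1 (G x (W s)) - f2 (G x (W s))" for s
    by (simp add: payoff_def)
  have "integrable (tilt P (payoff f1 x h)) (\<lambda>s. f1 (G x (W s)) - f2 (G x (W s)))"
    using i unfolding kernel_def by (subst (asm) integrable_distr_eq) auto
  then have "ln (\<integral>s. exp (payoff f1 x h s) \<partial>P) - ln (\<integral>s. exp (payoff f2 x h s) \<partial>P)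
    \<le> (\<integral>s. payoff f1 x h s - payoff f2 x h s \<partial>tilt P (payoff f1 x h))"
    using K f h by (intro ln_integral_exp_diff_le integrable_exp_payoff[of K]) (auto simp: eq)
  also have "\<dots> = (\<integral>z. f1 z - f2 z \<partial>kernel f1 x h)"
    unfolding kernel_def eq by (subst integral_distr) auto
  finally show ?thesis .
qed

section \<open>Estimates uniform over functions of bounded span\<close>

lemma uniform_drift:
  assumes K: "0 \<le> K"
  shows "\<exists>b C. 0 < b \<and> b < 1 \<and> 0 \<le> C \<and> (\<forall>f x. \<forall>h\<in>U. span_bounded K f \<longrightarrow>
    (\<integral>z. \<omega> z \<partial>kernel f x h) \<le> b * \<omega> x + C)"
proof -
  define r where "r = \<bar>\<gamma>\<bar> * b2 + 2 * K"
  \<comment> \<open>This makes the extra slope \<open>2 * r / p\<close> at most half of the gap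
    \<open>1 - b1\<close>; the summand 1 keeps \<open>p\<close> positive even if
    \<open>r = 0\<close>.\<close>
  define p where "p = 4 * r / (1 - b1) + 1"
  have r: "0 \<le> r" using K b2 by (simp add: r_def)
  then have p: "0 < p" using b1 by (simp add: p_def add_nonneg_pos)
  have "p * (1 - b1) = 4 * r + (1 - b1)"
    unfolding p_def distrib_right using b1 by simp
  then have "4 * r \<le> p * (1 - b1)" using b1 by simp
  then have le: "2 * r / p \<le> (1 - b1) / 2" using p by (simp add: field_simps)
  define C where "C = \<bar>(ln (\<integral>s. exp (p * a1 (W s) + noise_bound K s) \<partial>P)
      - ln (\<integral>s. exp (- noise_bound K s) \<partial>P) + 4 * K) / p\<bar>"
  have "(\<integral>z. \<omega> z \<partial>kernel f x h) \<le> (1 + b1) / 2 * \<omega> x + C"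
    if "h \<in> U" "span_bounded K f" for f x h
  proof -
    have "(\<integral>z. \<omega> z \<partial>kernel f x h) \<le> b1 * \<omega> x +
      (ln (\<integral>s. exp (p * a1 (W s) + noise_bound K s) \<partial>P) - ln (\<integral>s. exp (- noise_bound K s) \<partial>P)
       + 2 * (2 * K + r * \<omega> x)) / p"
      unfolding r_def by (rule kernel_drift(2)[OF K that(2,1) p])
    also have "\<dots> = (ln (\<integral>s. exp (p * a1 (W s) + noise_bound K s) \<partial>P)
      - ln (\<integral>s. exp (- noise_bound K s) \<partial>P) + 4 * K) / p + (b1 + 2 * r / p) * \<omega> x"
      using p by (simp add: field_simps)
    also have "\<dots> \<le> C + (b1 + (1 - b1) / 2) * \<omega> x"
      unfolding C_def using le \<omega>_nonneg
      by (intro add_mono abs_ge_self mult_right_mono) auto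
    finally show ?thesis by (simp add: field_simps)
  qed
  moreover have "0 \<le> C" by (simp add: C_def)
  ultimately show ?thesis using b1 by (intro exI[of _ "(1 + b1) / 2"] exI[of _ C]) auto
qed

text \<open>Squaring the hypothesis matches the squared probability in
  \<open>kernel_measure_ge\<close>. The cap \<open>R\<close> on the weight makes \<open>I\<close>,
  and so \<open>\<eta> = c^2 / I^2\<close>, independent of \<open>f\<close>, \<open>x\<close> and
  \<open>h\<close>.\<close>

lemma uniform_minorization:
  assumes K: "0 \<le> K" and c: "0 < c"
    and \<nu>: "\<And>x A. \<omega> x \<le> R \<Longrightarrow> A \<in> sets borel \<Longrightarrow> c * measure \<nu> A \<le> prob {s \<in> space P. G x (W s) \<in> A}"
  shows "\<exists>\<eta>>0. \<forall>f x. \<forall>h\<in>U. \<forall>A\<in>sets borel. span_bounded K f \<longrightarrow> \<omega> x \<le> R \<longrightarrow>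
    \<eta> * (measure \<nu> A)\<^sup>2 \<le> measure (kernel f x h) A"
proof -
  define I where "I = (\<integral>s. exp (noise_bound K s) \<partial>P) * exp (2 * K + (\<bar>\<gamma>\<bar> * b2 + 2 * K) * R)"
  have I: "0 < I"
    using integral_exp_pos[OF integrable_exp_noise_bound] by (simp add: I_def)
  have "c\<^sup>2 / I\<^sup>2 * (measure \<nu> A)\<^sup>2 \<le> measure (kernel f x h) A"
    if "h \<in> U" "A \<in> sets borel" "span_bounded K f" "\<omega> x \<le> R" for f x h A
  proof -
    have "(c * measure \<nu> A)\<^sup>2 \<le> (prob {s \<in> space P. G x (W s) \<in> A})\<^sup>2"
      using \<nu>[OF that(4,2)] c by (intro power_mono) auto
    then have "c\<^sup>2 / I\<^sup>2 * (measure \<nu> A)\<^sup>2 \<le> (prob {s \<in> space P. G x (W s) \<in> A})\<^sup>2 / I\<^sup>2"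
      using I by (simp add: power_mult_distrib divide_right_mono)
    also have "\<dots> \<le> measure (kernel f x h) A"
      unfolding I_def by (rule kernel_measure_ge[OF K that(3,1,2,4)])
    finally show ?thesis .
  qed
  then show ?thesis using I c by (intro exI[of _ "c\<^sup>2 / I\<^sup>2"]) auto
qed

section \<open>The contraction estimate\<close>

definition log_mgf :: "('x \<Rightarrow> real) \<Rightarrow> 'x \<Rightarrow> 'u \<Rightarrow> real" where
  "log_mgf f x h = ln (\<integral>s. exp (payoff f x h s) \<partial>P)"

text \<open>Each difference is linearised at the function with the plus sign, \<open>f1\<close> at
  \<open>(x, h)\<close> and \<open>f2\<close> at \<open>(y, h')\<close>. This leaves
  \<open>f1 - f2\<close> integrated against a difference of probability measures, where the
  centering constant cancels; \<open>weighted_dobrushin\<close> applies with weight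
  \<open>\<beta> * \<omega>\<close>.\<close>

lemma log_mgf_pair_bound:
  assumes K: "0 \<le> K" and f: "span_bounded K f1" "span_bounded K f2"
    and h: "h \<in> U" "h' \<in> U"
    and \<beta>: "0 \<le> \<beta>" and s: "0 \<le> s"
    and span: "\<And>x y. (f1 x - f2 x) - (f1 y - f2 y) \<le> s * (2 + \<beta> * \<omega> x + \<beta> * \<omega> y)"
    and \<nu>: "prob_space \<nu>" "sets \<nu> = sets borel" and \<eta>: "0 \<le> \<eta>"
    and minor: "\<And>A. A \<in> sets borel \<Longrightarrow> \<eta> * (measure \<nu> A)\<^sup>2 \<le> measure (kernel f1 x h) A"
      "\<And>A. A \<in> sets borel \<Longrightarrow> \<eta> * (measure \<nu> A)\<^sup>2 \<le> measure (kernel f2 y h') A"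
  shows "(log_mgf f1 x h - log_mgf f2 x h) + (log_mgf f2 y h' - log_mgf f1 y h') \<le>
    s * (2 - \<eta> / 2 + \<beta> * (\<integral>z. \<omega> z \<partial>kernel f1 x h) + \<beta> * (\<integral>z. \<omega> z \<partial>kernel f2 y h'))"
proof -
  obtain c where c: "\<And>z. \<bar>f1 z - f2 z + c\<bar> \<le> s * (1 + \<beta> * \<omega> z)"
    using span_centering[of "\<lambda>z. f1 z - f2 z" s "\<lambda>z. \<beta> * \<omega> z"] span by auto
  let ?q1 = "kernel f1 x h" and ?q2 = "kernel f2 y h'"
  interpret q1: prob_space ?q1 by (rule prob_space_kernel[OF K f(1) h(1)])
  interpret q2: prob_space ?q2 by (rule prob_space_kernel[OF K f(2) h(2)])
  note [measurable] = f_measurable[OF K f(1) h(1)] f_measurable[OF K f(2) h(1)]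
  note sets = sets_kernel[OF K f(1) h(1)] sets_kernel[OF K f(2) h(2)]
  \<comment> \<open>Integrability holds for any positive \<open>p\<close>; 1 is taken.\<close>
  note iw = kernel_drift(1)[OF K f(1) h(1) zero_less_one] kernel_drift(1)[OF K f(2) h(2) zero_less_one]
  have id: "integrable q (\<lambda>z. f1 z - f2 z)"
    if "integrable q \<omega>" "prob_space q" "sets q = sets borel" for q
  proof -
    interpret q: prob_space q by fact
    have "integrable q (\<lambda>z. f1 z - f2 z + c)"
    proof (rule Bochner_Integration.integrable_bound)
      show "integrable q (\<lambda>z. s * (1 + \<beta> * \<omega> z))" using that(1) by simp
      show "AE z in q. norm (f1 z - f2 z + c) \<le> norm (s * (1 + \<beta> * \<omega> z))"
        using c by (auto intro!: AE_I2 order_trans[OF _ abs_ge_self])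
      show "(\<lambda>z. f1 z - f2 z + c) \<in> borel_measurable q"
        using that(3) by (simp cong: measurable_cong_sets)
    qed
    then have "integrable q (\<lambda>z. (f1 z - f2 z + c) - c)" by (intro Bochner_Integration.integrable_diff) auto
    then show ?thesis by simp
  qed
  note id1 = id[OF iw(1) q1.prob_space_axioms sets(1)] and id2 = id[OF iw(2) q2.prob_space_axioms sets(2)]
  have "log_mgf f1 x h - log_mgf f2 x h \<le> (\<integral>z. f1 z - f2 z \<partial>?q1)"
    unfolding log_mgf_def by (rule ln_integral_diff_le[OF K f h(1) id1])
  moreover have "log_mgf f2 y h' - log_mgf f1 y h' \<le> (\<integral>z. f2 z - f1 z \<partial>?q2)"
    unfolding log_mgf_def
    by (rule ln_integral_diff_le[OF K f(2,1) h(2)])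
       (use Bochner_Integration.integrable_minus[OF id2] in simp)
  moreover have "(\<integral>z. f2 z - f1 z \<partial>?q2) = - (\<integral>z. f1 z - f2 z \<partial>?q2)"
    by (subst Bochner_Integration.integral_minus[symmetric]) simp
  moreover have "(\<integral>z. f1 z - f2 z + c \<partial>?q1) = (\<integral>z. f1 z - f2 z \<partial>?q1) + c"
    using id1 q1.prob_space by (subst Bochner_Integration.integral_add) auto
  moreover have "(\<integral>z. f1 z - f2 z + c \<partial>?q2) = (\<integral>z. f1 z - f2 z \<partial>?q2) + c"
    using id2 q2.prob_space by (subst Bochner_Integration.integral_add) auto
  moreover have "(\<integral>z. f1 z - f2 z + c \<partial>?q1) - (\<integral>z. f1 z - f2 z + c \<partial>?q2) \<le>
      s * (2 - \<eta> / 2 + (\<integral>z. \<beta> * \<omega> z \<partial>?q1) + (\<integral>z. \<beta> * \<omega> z \<partial>?q2))"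
    using \<beta> \<omega>_nonneg
    by (intro weighted_dobrushin[OF q1.prob_space_axioms q2.prob_space_axioms \<nu>(1) sets \<nu>(2)])
       (use iw c s \<eta> minor in auto)
  ultimately show ?thesis by simp
qed

text \<open>The lower bound does not involve \<open>h\<close>, so the real-valued infimum over
  \<open>U\<close> is a genuine one.\<close>

lemma bdd_below_log_mgf:
  assumes K: "0 \<le> K" and f: "span_bounded K f"
  shows "bdd_below (log_mgf f x ` U)"
  unfolding log_mgf_def by (rule bdd_belowI2) (rule ln_integral_exp_payoff_ge[OF K f])

text \<open>The drift constants determine \<open>R\<close>, then \<open>R\<close> determines
  \<open>\<eta>\<close>, and \<open>\<beta>\<close> is finally taken so small that the drift
  constant costs less than the minorization gains.\<close>

lemma local_contraction:
  assumes U: "U \<noteq> {}" and K: "0 \<le> K"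
    and minor: "\<forall>R>0. \<exists>c>0. \<exists>\<nu>. prob_space \<nu> \<and> sets \<nu> = sets borel \<and>
      (\<forall>x. \<forall>A\<in>sets borel. \<omega> x \<le> R \<longrightarrow> c * measure \<nu> A \<le> prob {s \<in> space P. G x (W s) \<in> A})"
  shows "\<exists>\<beta> L. 0 < \<beta> \<and> \<beta> < 1 \<and> 0 < L \<and> L < 1 \<and>
    (\<forall>f1 f2 s. span_bounded K f1 \<longrightarrow> span_bounded K f2 \<longrightarrow> 0 \<le> s \<longrightarrow>
      (\<forall>x y. (f1 x - f2 x) - (f1 y - f2 y) \<le> s * (2 + \<beta> * \<omega> x + \<beta> * \<omega> y)) \<longrightarrow>
      (\<forall>x y. ((INF h\<in>U. log_mgf f1 x h) - (INF h\<in>U. log_mgf f2 x h)) -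
             ((INF h\<in>U. log_mgf f1 y h) - (INF h\<in>U. log_mgf f2 y h))
        \<le> L * s * (2 + \<beta> * \<omega> x + \<beta> * \<omega> y)))"
proof -
  obtain b C where b: "0 < b" "b < 1" and C: "0 \<le> C"
    and drift: "\<And>f x h. h \<in> U \<Longrightarrow> span_bounded K f \<Longrightarrow> (\<integral>z. \<omega> z \<partial>kernel f x h) \<le> b * \<omega> x + C"
    using uniform_drift[OF K] by blast
  define b' where "b' = (1 + b) / 2"
  have b': "b < b'" "b' < 1" using b by (auto simp: b'_def)
  \<comment> \<open>Beyond this level \<open>(b' - b) * S\<close> pays for the drift constants of
    both points, with a surplus of 1.\<close>
  define R where "R = (2 * C + 1) / (b' - b)"
  have R: "0 < R" using b' C by (simp add: R_def)
  obtain c \<nu> where c: "0 < c" and \<nu>: "prob_space \<nu>" "sets \<nu> = sets borel"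
    and "\<And>x A. \<omega> x \<le> R \<Longrightarrow> A \<in> sets borel \<Longrightarrow> c * measure \<nu> A \<le> prob {s \<in> space P. G x (W s) \<in> A}"
    using minor[THEN spec, THEN mp, OF R] by blast
  from uniform_minorization[OF K c this(4)] obtain \<eta> where \<eta>: "0 < \<eta>"
    and min: "\<And>f x h A. h \<in> U \<Longrightarrow> A \<in> sets borel \<Longrightarrow> span_bounded K f \<Longrightarrow> \<omega> x \<le> R \<Longrightarrow>
      \<eta> * (measure \<nu> A)\<^sup>2 \<le> measure (kernel f x h) A"
    by blast
  \<comment> \<open>The gain \<open>\<eta> / 2\<close> is \<open>2 * \<kappa>\<close>: one
    \<open>\<kappa>\<close> pays for \<open>2 * \<beta> * C\<close>, the other remains for the
    contraction.\<close>
  define \<kappa> where "\<kappa> = \<eta> / 4"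
  define \<beta> where "\<beta> = min (1 / 2) (\<kappa> / (2 * (C + 1)))"
  \<comment> \<open>\<open>b'\<close> contracts the weighted part for large \<open>S\<close>; the
    constant part 2 is contracted by \<open>1 - \<beta> / 2\<close> for large \<open>S\<close> and
    by \<open>1 - \<kappa> / 2\<close> for small \<open>S\<close>.\<close>
  define L where "L = max b' (max (1 - \<beta> / 2) (1 - \<kappa> / 2))"
  have \<kappa>: "0 < \<kappa>" using \<eta> by (simp add: \<kappa>_def)
  have \<beta>: "0 < \<beta>" "\<beta> < 1" using \<kappa> C by (auto simp: \<beta>_def min_less_iff_disj)
  have "\<beta> \<le> \<kappa> / (2 * (C + 1))" by (simp add: \<beta>_def)
  then have "\<beta> * (2 * (C + 1)) \<le> \<kappa>" using C by (simp add: pos_le_divide_eq)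
  then have \<beta>C: "2 * \<beta> * C \<le> \<kappa>" using \<beta> by (simp add: algebra_simps)
  have L: "0 < L" "L < 1" "b' \<le> L" "1 - \<beta> / 2 \<le> L" "1 - \<kappa> / 2 \<le> L"
    using b b' \<beta> \<kappa> by (auto simp: L_def less_max_iff_disj)
  have main: "((INF h\<in>U. log_mgf f1 x h) - (INF h\<in>U. log_mgf f2 x h)) -
             ((INF h\<in>U. log_mgf f1 y h) - (INF h\<in>U. log_mgf f2 y h))
        \<le> L * s * (2 + \<beta> * \<omega> x + \<beta> * \<omega> y)"
    if f: "span_bounded K f1" "span_bounded K f2" and s: "0 \<le> s"
      and span: "\<forall>x y. (f1 x - f2 x) - (f1 y - f2 y) \<le> s * (2 + \<beta> * \<omega> x + \<beta> * \<omega> y)"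
    for f1 f2 s x y
  proof (rule INF_diff_diff_le[OF U bdd_below_log_mgf[OF K f(1)] bdd_below_log_mgf[OF K f(2)]
        bdd_below_log_mgf[OF K f(1)] bdd_below_log_mgf[OF K f(2)]])
    fix h h' assume h: "h \<in> U" "h' \<in> U"
    define D where "D = \<beta> * (\<integral>z. \<omega> z \<partial>kernel f1 x h) + \<beta> * (\<integral>z. \<omega> z \<partial>kernel f2 y h')"
    define S where "S = \<omega> x + \<omega> y"
    have "D \<le> \<beta> * (b * \<omega> x + C) + \<beta> * (b * \<omega> y + C)"
      unfolding D_def using \<beta> h f by (intro add_mono mult_left_mono drift) auto
    also have "\<dots> = b * (\<beta> * S) + 2 * \<beta> * C" by (simp add: S_def algebra_simps)
    finally have D: "D \<le> b * (\<beta> * S) + 2 * \<beta> * C" .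
    have S: "0 \<le> \<beta> * S" using \<omega>_nonneg \<beta> by (simp add: S_def)
    \<comment> \<open>The parameter \<open>e\<close> is \<open>\<eta>\<close> when both points have
      small weight, and 0 otherwise, where the minorization is trivial.\<close>
    have pair: "(log_mgf f1 x h - log_mgf f2 x h) + (log_mgf f2 y h' - log_mgf f1 y h') \<le> s * (2 - e / 2 + D)"
      if "0 \<le> e" "\<And>A. A \<in> sets borel \<Longrightarrow> e * (measure \<nu> A)\<^sup>2 \<le> measure (kernel f1 x h) A"
        "\<And>A. A \<in> sets borel \<Longrightarrow> e * (measure \<nu> A)\<^sup>2 \<le> measure (kernel f2 y h') A" for e
      unfolding D_def add.assoc[symmetric]
      by (rule log_mgf_pair_bound[OF K f h _ s _ \<nu>]) (use \<beta> span that in auto)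
    have "(log_mgf f1 x h - log_mgf f2 x h) + (log_mgf f2 y h' - log_mgf f1 y h') \<le> s * (L * (2 + \<beta> * S))"
    proof (cases "S \<le> R")
      case True
      then have "\<omega> x \<le> R" "\<omega> y \<le> R" using \<omega>_nonneg[of x] \<omega>_nonneg[of y] by (auto simp: S_def)
      then have "(log_mgf f1 x h - log_mgf f2 x h) + (log_mgf f2 y h' - log_mgf f1 y h') \<le> s * (2 - \<eta> / 2 + D)"
        using min f h \<eta> by (intro pair) auto
      also have "\<dots> \<le> s * (L * (2 + \<beta> * S))"
      proof (rule mult_left_mono[OF _ s])
        have "b * (\<beta> * S) \<le> L * (\<beta> * S)" using b' L S by (intro mult_right_mono) auto
        then show "2 - \<eta> / 2 + D \<le> L * (2 + \<beta> * S)"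
          using D \<beta>C L(5) unfolding distrib_left by (simp add: \<kappa>_def)
      qed
      finally show ?thesis .
    next
      case False
      \<comment> \<open>After multiplication by \<open>\<beta>\<close> the surplus 1 lowers the
        constant part from 2 to \<open>2 * (1 - \<beta> / 2)\<close>.\<close>
      have "2 * C + 1 \<le> (b' - b) * S"
        using False b' by (simp add: R_def pos_divide_less_eq mult.commute not_le)
      then have "\<beta> * (2 * C + 1) \<le> \<beta> * ((b' - b) * S)"
        using \<beta> by (intro mult_left_mono) auto
      then have "b * (\<beta> * S) + 2 * \<beta> * C + \<beta> \<le> b' * (\<beta> * S)" by (simp add: algebra_simps)
      also have "\<dots> \<le> L * (\<beta> * S)" using L S by (intro mult_right_mono) auto
      finally have "2 - 0 / 2 + D \<le> L * (2 + \<beta> * S)"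
        using D L(4) unfolding distrib_left by simp
      then have "s * (2 - 0 / 2 + D) \<le> s * (L * (2 + \<beta> * S))" by (rule mult_left_mono[OF _ s])
      then show ?thesis using pair[of 0] by simp
    qed
    then show "(log_mgf f1 x h - log_mgf f2 x h) + (log_mgf f2 y h' - log_mgf f1 y h') \<le>
        L * s * (2 + \<beta> * \<omega> x + \<beta> * \<omega> y)"
      by (simp add: S_def algebra_simps)
  qed
  show ?thesis
    by (rule exI[of _ \<beta>], rule exI[of _ L]) (use \<beta> L main in blast)
qed

end

section \<open>The contraction theorem\<close>

text \<open>For nonzero \<open>p\<close> an infinite exponential integral would make the utility
  infinite; for \<open>p = 0\<close> the integrand is 1.\<close>

lemma (in prob_space) integrable_exp_if_entropic_finite:
  assumes [measurable]: "Z \<in> borel_measurable M" and "\<bar>entropic_utility M p Z\<bar> \<noteq> \<infinity>"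
  shows "integrable M (\<lambda>s. exp (p * Z s))"
proof (cases "p = 0")
  case False
  have "(\<integral>\<^sup>+ s. ennreal (exp (p * Z s)) \<partial>M) < \<infinity>"
    using assms(2) False by (auto simp: entropic_utility_def ext_ln_def less_top split: if_splits)
  then show ?thesis by (intro integrableI_nonneg) auto
qed simp

lemma span_seminorm_leD:
  assumes "span_seminorm \<omega> f \<le> ereal K" "\<And>x. 0 \<le> \<omega> x"
  shows "f x - f y \<le> K * (2 + \<omega> x + \<omega> y)"
proof -
  have "ereal ((f x - f y) / (2 + \<omega> x + \<omega> y)) \<le> ereal K"
    using assms(1) by (auto simp: span_seminorm_def SUP_le_iff)
  moreover have "0 < 2 + \<omega> x + \<omega> y" using assms(2)[of x] assms(2)[of y] by linarith
  ultimately show ?thesis by (simp add: pos_divide_le_eq)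
qed

text \<open>An infinite seminorm of \<open>d\<close> makes the right side infinite, as
  \<open>L\<close> is positive; otherwise \<open>s\<close> is the seminorm itself.\<close>

lemma span_seminorm_scaled_contractionI:
  assumes L: "0 < L" and \<beta>: "0 < \<beta>" and \<omega>: "\<And>x. 0 \<le> \<omega> x"
    and le: "\<And>s x y. 0 \<le> s \<Longrightarrow> (\<And>x y. d x - d y \<le> s * (2 + \<beta> * \<omega> x + \<beta> * \<omega> y)) \<Longrightarrow>
      g x - g y \<le> L * s * (2 + \<beta> * \<omega> x + \<beta> * \<omega> y)"
  shows "span_seminorm_scaled \<beta> \<omega> g \<le> ereal L * span_seminorm_scaled \<beta> \<omega> d"
proof -
  have pos: "0 < 2 + \<beta> * \<omega> x + \<beta> * \<omega> y" for x y
    using \<omega>[of x] \<omega>[of y] \<beta> by (simp add: add_pos_nonneg)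
  have up: "ereal ((d x - d y) / (2 + \<beta> * \<omega> x + \<beta> * \<omega> y)) \<le> span_seminorm_scaled \<beta> \<omega> d" for x y
    unfolding span_seminorm_scaled_def by (rule SUP_upper2[of "(x, y)"]) auto
  \<comment> \<open>A diagonal pair gives the quotient 0.\<close>
  have "0 \<le> span_seminorm_scaled \<beta> \<omega> d"
    using up[of undefined undefined] by (simp add: zero_ereal_def)
  then consider "span_seminorm_scaled \<beta> \<omega> d = \<infinity>" | s where "0 \<le> s" "span_seminorm_scaled \<beta> \<omega> d = ereal s"
    by (cases "span_seminorm_scaled \<beta> \<omega> d") auto
  then show ?thesis
  proof cases
    case 1
    then show ?thesis using L by simp
  next
    case (2 s)
    then have "d x - d y \<le> s * (2 + \<beta> * \<omega> x + \<beta> * \<omega> y)" for x y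
      using up[of x y] pos[of x y] by (simp add: pos_divide_le_eq)
    then have "g x - g y \<le> L * s * (2 + \<beta> * \<omega> x + \<beta> * \<omega> y)" for x y
      by (intro le 2(1))
    then have "span_seminorm_scaled \<beta> \<omega> g \<le> ereal (L * s)"
      unfolding span_seminorm_scaled_def using pos by (auto intro!: SUP_least simp: pos_divide_le_eq)
    with 2 show ?thesis by simp
  qed
qed

theorem theorem4p3:
  fixes P :: "'a measure" and Fil :: "nat \<Rightarrow> 'a measure"
    and W :: "nat \<Rightarrow> 'a \<Rightarrow> real ^ ('k::finite + 'm::finite)"
    and U :: "(real ^ 'm) set"
    and G :: "real ^ 'k \<Rightarrow> real ^ ('k + 'm) \<Rightarrow> real ^ 'k"
    and x0 :: "real ^ 'k" and X :: "nat \<Rightarrow> 'a \<Rightarrow> real ^ 'k"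
    and F :: "real ^ 'k \<Rightarrow> real ^ 'm \<Rightarrow> real ^ ('k + 'm) \<Rightarrow> real"
    and V0 :: real and V :: "(nat \<Rightarrow> 'a \<Rightarrow> real ^ 'm) \<Rightarrow> nat \<Rightarrow> 'a \<Rightarrow> real"
    and \<omega> :: "real ^ 'k \<Rightarrow> real"
    and \<gamma> :: real
  assumes "filtered_prob_space P Fil"
    and "compact U" and "U \<noteq> {}"
    and "noise P Fil W"
    and "factors P W G x0 X"
    and "portfolio P Fil W U X F V0 V"
    and "growth P W U G F \<omega>"
    and "minorization P W G \<omega>"
    and "\<gamma> < 0"
  shows "\<exists>(\<beta> :: real \<Rightarrow> real) (L :: real \<Rightarrow> real).
    (\<forall>M\<ge>0. 0 < \<beta> M \<and> \<beta> M < 1 \<and> 0 < L M \<and> L M < 1) \<and>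
    (\<forall>M\<ge>0. \<forall>f1\<in>weighted_space \<omega>. \<forall>f2\<in>weighted_space \<omega>.
       span_seminorm \<omega> f1 \<le> ereal M \<longrightarrow> span_seminorm \<omega> f2 \<le> ereal M \<longrightarrow>
       span_seminorm_scaled (\<beta> M) \<omega>
         (\<lambda>x. risk_operator P W U G F \<gamma> f1 x - risk_operator P W U G F \<gamma> f2 x)
       \<le> ereal (L M) * span_seminorm_scaled (\<beta> M) \<omega> (\<lambda>x. f1 x - f2 x))"
proof -
  interpret prob_space P using assms(1) by (simp add: filtered_prob_space_def)
  have W0 [measurable]: "W 0 \<in> P \<rightarrow>\<^sub>M borel"
    using assms(4) by (auto simp: noise_def indep_vars_def)
  have "(\<lambda>(x, w). G x w) \<in> borel \<Otimes>\<^sub>M borel \<rightarrow>\<^sub>M borel"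
    using assms(5) by (simp add: factors_def)
  from measurable_compose[OF measurable_Pair1' this] have G: "G x \<in> borel \<rightarrow>\<^sub>M borel" for x
    by simp
  have F_joint: "(\<lambda>(x, h, w). F x h w) \<in> borel_measurable (borel \<Otimes>\<^sub>M restrict_space borel U \<Otimes>\<^sub>M borel)"
    using assms(6) by (simp add: portfolio_def)
  \<comment> \<open>The section at \<open>h\<close> is taken inside
    \<open>restrict_space borel U\<close>, whence the condition \<open>h \<in> U\<close>.\<close>
  have F: "F x h \<in> borel_measurable borel" if "h \<in> U" for x h
    using measurable_compose[OF measurable_compose[OF measurable_Pair1' measurable_Pair1'] F_joint, of h x] that
    by (simp add: space_restrict_space space_pair_measure)
  obtain a1 a2 b1 b2 where bounds: "a1 \<in> borel_measurable borel \<and> a2 \<in> borel_measurable borel \<and>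
      (\<forall>w. 0 \<le> a1 w) \<and> (\<forall>w. 0 \<le> a2 w) \<and> 0 < b1 \<and> b1 < 1 \<and> 0 < b2 \<and>
      (\<forall>x w. \<omega> (G x w) \<le> a1 w + b1 * \<omega> x) \<and>
      (\<forall>x. \<forall>h\<in>U. \<forall>w. \<bar>F x h w\<bar> \<le> a2 w + b2 * \<omega> x) \<and>
      (\<forall>p. \<bar>entropic_utility P p (\<lambda>s. a1 (W 0 s))\<bar> \<noteq> \<infinity> \<and>
           \<bar>entropic_utility P p (\<lambda>s. a2 (W 0 s))\<bar> \<noteq> \<infinity>)"
    using assms(7) unfolding growth_def by metis
  have weight: "continuous_on UNIV \<omega>" "\<And>x. 0 \<le> \<omega> x"
    using assms(7) by (auto simp: growth_def)
  have [measurable]: "a1 \<in> borel_measurable borel" "a2 \<in> borel_measurable borel"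
    using bounds by auto
  interpret growth_model P "W 0" U G F \<omega> \<gamma> a1 a2 b1 b2
  proof
    show "\<omega> \<in> borel_measurable borel" using weight(1) by (rule borel_measurable_continuous_onI)
    fix p :: real
    have "\<bar>entropic_utility P p (\<lambda>s. a1 (W 0 s))\<bar> \<noteq> \<infinity>" "\<bar>entropic_utility P p (\<lambda>s. a2 (W 0 s))\<bar> \<noteq> \<infinity>"
      using bounds by metis+
    then show "integrable P (\<lambda>s. exp (p * a1 (W 0 s)))" "integrable P (\<lambda>s. exp (p * a2 (W 0 s)))"
      using integrable_exp_if_entropic_finite[of "\<lambda>s. a1 (W 0 s)" p]
        integrable_exp_if_entropic_finite[of "\<lambda>s. a2 (W 0 s)" p] by simp_all
  qed (use bounds weight(2) G F W0 in auto)
  have minor: "\<forall>R>0. \<exists>c>0. \<exists>\<nu>. prob_space \<nu> \<and> sets \<nu> = sets borel \<and>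
      (\<forall>x. \<forall>A\<in>sets borel. \<omega> x \<le> R \<longrightarrow> c * measure \<nu> A \<le> prob {s \<in> space P. G x (W 0 s) \<in> A})"
  proof (intro allI impI)
    fix R :: real assume "0 < R"
    obtain c \<nu> where c: "0 < c" and \<nu>: "prob_space \<nu>" "sets \<nu> = sets borel"
      and le: "\<forall>A\<in>sets borel. ennreal c * emeasure \<nu> A
          \<le> (INF x\<in>{x. \<omega> x \<le> R}. emeasure P {s \<in> space P. G x (W 0 s) \<in> A})"
      using assms(8)[unfolded minorization_def, rule_format, OF \<open>0 < R\<close>]
      by (elim exE conjE) (rule that)
    interpret \<nu>: prob_space \<nu> by fact
    have "c * measure \<nu> A \<le> prob {s \<in> space P. G x (W 0 s) \<in> A}"
      if "A \<in> sets borel" "\<omega> x \<le> R" for x A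
    proof -
      have "ennreal c * emeasure \<nu> A \<le> emeasure P {s \<in> space P. G x (W 0 s) \<in> A}"
        using le[THEN bspec, OF that(1)] that(2) by (simp add: le_INF_iff)
      then show ?thesis
        using c by (simp add: emeasure_eq_measure \<nu>.emeasure_eq_measure ennreal_mult[symmetric])
    qed
    then show "\<exists>c>0. \<exists>\<nu>. prob_space \<nu> \<and> sets \<nu> = sets borel \<and>
      (\<forall>x. \<forall>A\<in>sets borel. \<omega> x \<le> R \<longrightarrow> c * measure \<nu> A \<le> prob {s \<in> space P. G x (W 0 s) \<in> A})"
      using c \<nu> by (intro exI[of _ c] conjI exI[of _ \<nu>]) auto
  qed
  have T: "risk_operator P W U G F \<gamma> f x = (INF h\<in>U. log_mgf f x h)" for f x
    by (simp add: risk_operator_def log_mgf_def payoff_def)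
  have span: "span_bounded K f" if "f \<in> weighted_space \<omega>" "span_seminorm \<omega> f \<le> ereal K" for f K
    unfolding span_bounded_def
    using that(1) span_seminorm_leD[OF that(2) weight(2)]
    by (simp add: weighted_space_def borel_measurable_continuous_onI)
  let ?contr = "\<lambda>K \<beta> L. 0 < \<beta> \<and> \<beta> < 1 \<and> 0 < L \<and> L < 1 \<and>
    (\<forall>f1\<in>weighted_space \<omega>. \<forall>f2\<in>weighted_space \<omega>.
       span_seminorm \<omega> f1 \<le> ereal K \<longrightarrow> span_seminorm \<omega> f2 \<le> ereal K \<longrightarrow>
       span_seminorm_scaled \<beta> \<omega>
         (\<lambda>x. risk_operator P W U G F \<gamma> f1 x - risk_operator P W U G F \<gamma> f2 x)
       \<le> ereal L * span_seminorm_scaled \<beta> \<omega> (\<lambda>x. f1 x - f2 x))"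
  \<comment> \<open>The implication stands under the existential so that \<open>choice\<close>
    yields functions on all reals, with arbitrary values at negative \<open>K\<close>.\<close>
  have "\<forall>K. \<exists>\<beta> L. 0 \<le> K \<longrightarrow> ?contr K \<beta> L"
  proof
    fix K :: real
    show "\<exists>\<beta> L. 0 \<le> K \<longrightarrow> ?contr K \<beta> L"
    proof (cases "0 \<le> K")
      case True
      obtain \<beta> L where \<beta>: "0 < \<beta>" "\<beta> < 1" and L: "0 < L" "L < 1"
        and le: "\<forall>f1 f2 s. span_bounded K f1 \<longrightarrow> span_bounded K f2 \<longrightarrow> 0 \<le> s \<longrightarrow>
          (\<forall>x y. (f1 x - f2 x) - (f1 y - f2 y) \<le> s * (2 + \<beta> * \<omega> x + \<beta> * \<omega> y)) \<longrightarrow>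
          (\<forall>x y. ((INF h\<in>U. log_mgf f1 x h) - (INF h\<in>U. log_mgf f2 x h)) -
             ((INF h\<in>U. log_mgf f1 y h) - (INF h\<in>U. log_mgf f2 y h))
          \<le> L * s * (2 + \<beta> * \<omega> x + \<beta> * \<omega> y))"
        using local_contraction[OF assms(3) True minor] by (elim exE conjE) (rule that)
      have "span_seminorm_scaled \<beta> \<omega>
         (\<lambda>x. risk_operator P W U G F \<gamma> f1 x - risk_operator P W U G F \<gamma> f2 x)
         \<le> ereal L * span_seminorm_scaled \<beta> \<omega> (\<lambda>x. f1 x - f2 x)"
        if "f1 \<in> weighted_space \<omega>" "f2 \<in> weighted_space \<omega>"
          "span_seminorm \<omega> f1 \<le> ereal K" "span_seminorm \<omega> f2 \<le> ereal K" for f1 f2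
        unfolding T using L(1) \<beta>(1) weight(2)
      proof (rule span_seminorm_scaled_contractionI)
        fix s x y
        assume "0 \<le> s" "\<And>x y. (f1 x - f2 x) - (f1 y - f2 y) \<le> s * (2 + \<beta> * \<omega> x + \<beta> * \<omega> y)"
        then show "((INF h\<in>U. log_mgf f1 x h) - (INF h\<in>U. log_mgf f2 x h)) -
             ((INF h\<in>U. log_mgf f1 y h) - (INF h\<in>U. log_mgf f2 y h))
          \<le> L * s * (2 + \<beta> * \<omega> x + \<beta> * \<omega> y)"
          by (intro le[rule_format] span that)
      qed
      then show ?thesis using \<beta> L by (intro exI[of _ \<beta>] exI[of _ L]) simp
    qed simp
  qed
  from choice[OF this] obtain \<beta> where "\<forall>K. \<exists>L. 0 \<le> K \<longrightarrow> ?contr K (\<beta> K) L"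
    by (elim exE) (rule that)
  from choice[OF this] obtain L where "\<forall>K. 0 \<le> K \<longrightarrow> ?contr K (\<beta> K) (L K)"
    by (elim exE) (rule that)
  then show ?thesis by (intro exI[of _ \<beta>] exI[of _ L]) simp
qed

end
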